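(* Suppose $f$ is nonnegative and integrable on a rectifiable Jordan curve $J\subset\mathbb{C}$ with $\int_J f\,|dz|>0$. If $F:J\to\partial\mathbb{D}$ is a homeomorphism, then a unique point $w\in\mathbb{D}$ exists such that $T_w\circ F$ is orthogonal to $f$: $$\int_J T_w(F(z))\,f(z)\,|dz|=0.$$
   Context: $\mathbb{D}$ is the open unit disk in the complex plane $\mathbb{C}$, with closure $\overline{\mathbb{D}}$ and boundary circle $\partial\mathbb{D}$. For $w\in\mathbb{D}$, $T_w(z)=\dfrac{z+w}{1+z\overline{w}}$ for $z\in\overline{\mathbb{D}}$. $|dz|$ denotes the arclength measure on $J$. *)

theory Defs
  imports "HOL-Analysis.Analysis"
begin

text \<open>Length of the polygonal line inscribed in \<open>g\<close> with vertices at the endpoints of the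
  intervals of a division \<open>D\<close> of a real interval.\<close>

definition chord_sum :: "(real \<Rightarrow> 'a::metric_space) \<Rightarrow> real set set \<Rightarrow> real" where
  "chord_sum g D = (\<Sum>I\<in>D. dist (g (Inf I)) (g (Sup I)))"

definition rectifiable_path :: "(real \<Rightarrow> 'a::metric_space) \<Rightarrow> bool" where
  "rectifiable_path g \<longleftrightarrow> path g \<and> bdd_above (chord_sum g ` {D. D division_of {0..1}})"

definition arclength :: "(real \<Rightarrow> 'a::metric_space) \<Rightarrow> real \<Rightarrow> real" where
  "arclength g t = (SUP D\<in>{D. D division_of {0..t}}. chord_sum g D)"

text \<open>Parametrization by arclength, defined on \<open>{0..arclength g 1}\<close>. For a rectifiable path that
  is constant on no nontrivial subinterval (in particular for a simple one), \<open>arclength g\<close> is a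
  continuous strictly increasing bijection from \<open>{0..1}\<close> onto that interval.\<close>

definition arclength_param :: "(real \<Rightarrow> 'a::metric_space) \<Rightarrow> real \<Rightarrow> 'a" where
  "arclength_param g s = g (inv_into {0..1} (arclength g) s)"

text \<open>The measure \<open>|dz|\<close> on the image of a rectifiable simple path \<open>g\<close>, closed or not: Lebesgue
  measure pushed forward by the arclength parametrization. It depends on the image of \<open>g\<close> only.
  Because of the completion, a function is integrable for it iff its composition with the
  arclength parametrization is Lebesgue integrable.\<close>

definition arclength_measure :: "(real \<Rightarrow> 'a::metric_space) \<Rightarrow> 'a measure" where
  "arclength_measure g =
     completion (distr (restrict_space lborel {0..arclength g 1})
       (restrict_space borel (path_image g)) (arclength_param g))"

definition disk_moebius :: "complex \<Rightarrow> complex \<Rightarrow> complex" where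
  "disk_moebius w z = (z + w) / (1 + z * cnj w)"

end

theory Submission
  imports Defs
begin

text \<open>
  Let \<open>\<mu>\<close> be the measure \<open>f |dz|\<close>; it has no atoms, because arclength is continuous along \<open>g\<close>.
  Put \<open>H w = \<integral> T\<^sub>w \<circ> F d\<mu>\<close> for \<open>w\<close> in the closed disk. For \<open>|w| = 1\<close> the map \<open>T\<^sub>w\<close> is constantly \<open>w\<close>
  on the circle except at \<open>-w\<close>, so by dominated convergence \<open>H\<close> is continuous up to the boundary,
  where it is a positive multiple of the identity; Brouwer's no-retraction theorem yields a zero.
  If \<open>u\<close> and \<open>v\<close> are zeros, then \<open>T\<^sub>v\<close> is up to a rotation \<open>T\<^sub>a \<circ> T\<^sub>u\<close> with
  \<open>a = (v - u) / (1 - v cnj u)\<close>, and uniqueness follows from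
  \<open>Re (cnj a (T\<^sub>a z - z)) = 2 (Im (z cnj a))\<^sup>2 / |1 + z cnj a|\<^sup>2\<close> on the circle.
\<close>

subsection \<open>Arclength\<close>

lemma division_interval_bounds:
  fixes D :: "real set set"
  assumes "D division_of {a..b}" "K \<in> D"
  shows "K = {Inf K..Sup K}" "a \<le> Inf K" "Inf K \<le> Sup K" "Sup K \<le> b"
proof -
  obtain u v where K: "K = {u..v}" "K \<noteq> {}" "K \<subseteq> {a..b}"
    using division_ofD(2,3,4)[OF assms] by auto
  then show "K = {Inf K..Sup K}" "a \<le> Inf K" "Inf K \<le> Sup K" "Sup K \<le> b"
    by auto
qed

text \<open>An interval in both divisions is degenerate, so merging the divisions loses no
  length.\<close>

lemma chord_sum_Un:
  fixes g :: "real \<Rightarrow> 'a::metric_space"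
  assumes D: "D division_of {a..b}" and E: "E division_of {b..c}" and "a \<le> b" "b \<le> c"
  shows "D \<union> E division_of {a..c}"
    and "chord_sum g (D \<union> E) = chord_sum g D + chord_sum g E"
proof -
  have "interior {a..b} \<inter> interior {b..c} = {}"
    by (auto simp: interior_atLeastAtMost_real)
  from division_disjoint_union[OF D E this] show "D \<union> E division_of {a..c}"
    using assms(3,4) by (simp add: ivl_disj_un)
  have "dist (g (Inf K)) (g (Sup K)) = 0" if "K \<in> D \<inter> E" for K
  proof -
    have "Inf K = Sup K"
      using division_interval_bounds[OF D, of K] division_interval_bounds[OF E, of K] that by auto
    then show ?thesis by simp
  qed
  then have "(\<Sum>K\<in>D \<inter> E. dist (g (Inf K)) (g (Sup K))) = 0"
    by (rule sum.neutral[OF ballI])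
  with sum.union_inter[OF division_ofD(1)[OF D] division_ofD(1)[OF E],
      of "\<lambda>K. dist (g (Inf K)) (g (Sup K))"]
  show "chord_sum g (D \<union> E) = chord_sum g D + chord_sum g E"
    unfolding chord_sum_def by simp
qed

text \<open>Clamping both endpoints to \<open>{c..d}\<close> truncates each interval, and intervals
  missing \<open>{c..d}\<close> collapse to a point. The sum thus runs over the fixed index set
  \<open>D\<close>, which makes its continuous dependence on \<open>c\<close> and \<open>d\<close>
  visible.\<close>

lemma chord_sum_restrict:
  fixes g :: "real \<Rightarrow> 'a::metric_space"
  assumes D: "D division_of {a..b}" and "a \<le> c" "c \<le> d" "d \<le> b"
  obtains E where "E division_of {c..d}"
    "chord_sum g E =
      (\<Sum>K\<in>D. dist (g (max c (min d (Inf K)))) (g (max c (min d (Sup K)))))"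
proof
  define D' where "D' = {K \<in> D. {c..d} \<inter> K \<noteq> {}}"
  define E where "E = (\<lambda>K. {c..d} \<inter> K) ` D'"
  have "E = {{c..d} \<inter> K |K. K \<in> D \<and> {c..d} \<inter> K \<noteq> {}}"
    by (auto simp: E_def D'_def)
  then show "E division_of {c..d}"
    using division_inter_1[OF D, of c d] assms by simp
  have fin: "finite D" "finite D'"
    using D by (auto simp: D'_def)
  have Int: "Inf ({c..d} \<inter> K) = max c (min d (Inf K))" "Sup ({c..d} \<inter> K) = max c (min d (Sup K))"
      "{c..d} \<inter> K = {Inf ({c..d} \<inter> K)..Sup ({c..d} \<inter> K)}"
    if "K \<in> D'" for K
  proof -
    note K = division_interval_bounds[OF D, of K]
    define u v where "u = Inf K" and "v = Sup K"
    have eq: "K = {u..v}" using K that by (auto simp: D'_def u_def v_def)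
    have ne: "max c u \<le> min d v" using that unfolding D'_def eq by auto
    have eq2: "{c..d} \<inter> K = {max c u..min d v}" unfolding eq by auto
    show "Inf ({c..d} \<inter> K) = max c (min d (Inf K))" "Sup ({c..d} \<inter> K) = max c (min d (Sup K))"
      "{c..d} \<inter> K = {Inf ({c..d} \<inter> K)..Sup ({c..d} \<inter> K)}"
      using ne K(3) that assms(3) unfolding eq2 D'_def u_def v_def by (auto simp: max_def min_def)
  qed
  \<comment> \<open>Distinct members of \<open>D'\<close> can have the same intersection with
    \<open>{c..d}\<close>, but their interiors are disjoint, so it is a single point with chord
    0.\<close>
  have "chord_sum g E = (\<Sum>K\<in>D'. dist (g (Inf ({c..d} \<inter> K))) (g (Sup ({c..d} \<inter> K))))"
    unfolding chord_sum_def E_def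
  proof (subst sum.reindex_nontrivial[OF fin(2)])
    fix K1 K2 assume *: "K1 \<in> D'" "K2 \<in> D'" "K1 \<noteq> K2" "{c..d} \<inter> K1 = {c..d} \<inter> K2"
    let ?u = "Inf ({c..d} \<inter> K1)" and ?v = "Sup ({c..d} \<inter> K1)"
    have "?u = ?v"
    proof (rule ccontr)
      have I: "{c..d} \<inter> K1 = {?u..?v}" by (rule Int(3)[OF *(1)])
      moreover have "?u \<le> ?v" using I *(1) unfolding D'_def by (metis (lifting) atLeastatMost_empty_iff mem_Collect_eq)
      moreover assume "?u \<noteq> ?v"
      ultimately have "interior ({c..d} \<inter> K1) \<noteq> {}"
        by (metis interior_atLeastAtMost_real greaterThanLessThan_empty_iff order_le_less not_le)
      moreover have "interior ({c..d} \<inter> K1) \<subseteq> interior K1" "interior ({c..d} \<inter> K1) \<subseteq> interior K2"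
        using *(4) by (metis inf_le2 interior_mono)+
      ultimately show False
        using division_ofD(5)[OF D, of K1 K2] * by (auto simp: D'_def)
    qed
    then show "dist (g ?u) (g ?v) = 0" by simp
  qed simp
  also have "\<dots> = (\<Sum>K\<in>D'. dist (g (max c (min d (Inf K)))) (g (max c (min d (Sup K)))))"
    by (intro sum.cong refl) (simp add: Int(1,2))
  also have "\<dots> = (\<Sum>K\<in>D. dist (g (max c (min d (Inf K)))) (g (max c (min d (Sup K)))))"
  proof (intro sum.mono_neutral_left fin ballI)
    fix K assume K: "K \<in> D - D'"
    note b = division_interval_bounds[OF D, of K]
    have "{c..d} \<inter> {Inf K..Sup K} = {}" using K b(1) by (auto simp: D'_def)
    then have "d < Inf K \<or> Sup K < c" using b(3) K assms(3) by (auto simp: not_le)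
    then have "max c (min d (Inf K)) = max c (min d (Sup K))"
      using b(3) K assms(3) by (auto simp: max_def min_def)
    then show "dist (g (max c (min d (Inf K)))) (g (max c (min d (Sup K)))) = 0" by simp
  qed (auto simp: D'_def)
  finally show "chord_sum g E =
      (\<Sum>K\<in>D. dist (g (max c (min d (Inf K)))) (g (max c (min d (Sup K)))))" .
qed

text \<open>If a division \<open>D\<close> nearly attains the length of \<open>g\<close>, then so do its truncations at \<open>t\<close> for
  the arcs before and after \<open>t\<close>. Hence \<open>arclength g\<close> is a uniform limit of the chord sums of
  truncated divisions, which are continuous in \<open>t\<close>.\<close>

lemma continuous_on_arclength:
  fixes g :: "real \<Rightarrow> 'a::metric_space"
  assumes "rectifiable_path g"
  shows "continuous_on {0..1} (arclength g)"
proof -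
  have g: "continuous_on {0..1} g" and bdd: "bdd_above (chord_sum g ` {D. D division_of {0..1}})"
    using assms by (auto simp: rectifiable_path_def path_def)
  have triv: "{{s..t}} division_of {s..t}" if "s \<le> t" for s t :: real
    using division_of_self[of s t] that by simp
  have add: "chord_sum g D + chord_sum g E \<le> arclength g 1"
    if "D division_of {0..t}" "E division_of {t..1}" "t \<in> {0..1}" for D E t
    using chord_sum_Un(1)[OF that(1,2)] chord_sum_Un(2)[OF that(1,2), of g] that(3) cSUP_upper[OF _ bdd, of "D \<union> E"]
    unfolding arclength_def by auto
  \<comment> \<open>Appending the single interval \<open>{t..1}\<close> reduces the bound to the
    total length.\<close>
  have bdd': "bdd_above (chord_sum g ` {D. D division_of {0..t}})" if t: "t \<in> {0..1}" for t
  proof (intro bdd_aboveI2)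
    fix D assume "D \<in> {D. D division_of {0..t}}"
    then have "chord_sum g D + dist (g t) (g 1) \<le> arclength g 1"
      using add[of D t "{{t..1}}"] t triv[of t 1] by (simp add: chord_sum_def)
    then show "chord_sum g D \<le> arclength g 1"
      by (rule order_trans[rotated]) simp
  qed
  have "\<exists>h. continuous_on {0..1} h \<and> (\<forall>t\<in>{0..1}. dist (h t) (arclength g t) < e)"
    if "e > 0" for e
  proof -
    have ne: "{D. D division_of {0..1::real}} \<noteq> {}" using triv[of 0 1] by auto
    have "arclength g 1 - e < (SUP D\<in>{D. D division_of {0..1}}. chord_sum g D)"
      using that by (simp add: arclength_def)
    then obtain D where D: "D division_of {0..1}" and De: "arclength g 1 - e < chord_sum g D"
      unfolding less_cSUP_iff[OF ne bdd] by blast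
    define h where "h t = (\<Sum>K\<in>D. dist (g (max 0 (min t (Inf K)))) (g (max 0 (min t (Sup K)))))" for t
    define k where "k t = (\<Sum>K\<in>D. dist (g (max t (min 1 (Inf K)))) (g (max t (min 1 (Sup K)))))" for t
    note b = division_interval_bounds[OF D]
    have "continuous_on {0..1} h"
      unfolding h_def
      by (intro continuous_intros continuous_on_compose2[OF g]) auto
    moreover have "dist (h t) (arclength g t) < e" if t: "t \<in> {0..1}" for t
    proof -
      obtain E where E: "E division_of {0..t}" "chord_sum g E = h t"
        using chord_sum_restrict[OF D, of 0 t] t unfolding h_def by auto
      obtain E' where E': "E' division_of {t..1}" "chord_sum g E' = k t"
        using chord_sum_restrict[OF D, of t 1] t unfolding k_def by auto
      have h: "h t \<le> arclength g t"
        using cSUP_upper[OF _ bdd'[OF t], of E] E by (simp add: arclength_def)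
      have "chord_sum g D \<le> h t + k t"
        unfolding chord_sum_def h_def k_def sum.distrib[symmetric]
      proof (rule sum_mono)
        fix K assume K: "K \<in> D"
        have bounds: "0 \<le> Inf K" "Inf K \<le> Sup K" "Sup K \<le> 1" "0 \<le> Sup K" "Inf K \<le> 1"
          using b[OF K] by linarith+
        \<comment> \<open>If \<open>t\<close> lies in \<open>K\<close>, the chord is split at
          \<open>g t\<close> and the triangle inequality applies; otherwise one truncated chord is
          the whole chord and the other is degenerate.\<close>
        consider "Sup K \<le> t" | "t \<le> Inf K" | "Inf K \<le> t" "t \<le> Sup K" by linarith
        then show "dist (g (Inf K)) (g (Sup K)) \<le>
          dist (g (max 0 (min t (Inf K)))) (g (max 0 (min t (Sup K)))) +
          dist (g (max t (min 1 (Inf K)))) (g (max t (min 1 (Sup K))))"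
          using bounds t
          by cases (simp_all add: min_absorb1 max_absorb1 min_absorb2 max_absorb2 dist_triangle)
      qed
      \<comment> \<open>Every division of \<open>{0..t}\<close>, extended by the fixed
        \<open>E'\<close>, has chord sum at most the total length.\<close>
      moreover have "arclength g t \<le> arclength g 1 - k t"
        unfolding arclength_def[of g t]
      proof (rule cSUP_least)
        show "{D. D division_of {0..t}} \<noteq> {}" using E(1) by auto
      qed (use add[OF _ E'(1) t] E'(2) in fastforce)
      ultimately show ?thesis using h De by (simp add: dist_real_def)
    qed
    ultimately show ?thesis by blast
  qed
  then have "\<forall>n. \<exists>h. continuous_on {0..1} h \<and>
      (\<forall>t\<in>{0..1}. dist (h t) (arclength g t) < inverse (real (Suc n)))"
    by simp
  then obtain h where h: "\<forall>n. continuous_on {0..1} (h n) \<and>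
      (\<forall>t\<in>{0..1}. dist (h n t) (arclength g t) < inverse (real (Suc n)))"
    by (rule choice[THEN exE])
  have "uniform_limit {0..1} h (arclength g) sequentially"
  proof (rule uniform_limitI)
    fix e :: real assume "e > 0"
    then have "\<forall>\<^sub>F n in sequentially. inverse (real (Suc n)) < e"
      using LIMSEQ_inverse_real_of_nat order_tendstoD(2) by blast
    then show "\<forall>\<^sub>F n in sequentially. \<forall>t\<in>{0..1}. dist (h n t) (arclength g t) < e"
    proof (rule eventually_mono, intro ballI)
      fix n t assume "inverse (real (Suc n)) < e" "t \<in> {0..1::real}"
      then show "dist (h n t) (arclength g t) < e" using h less_trans by blast
    qed
  qed
  with h show ?thesis
    by (intro uniform_limit_theorem[OF always_eventually _ sequentially_bot]) auto
qed

lemma arclength_0: "arclength g 0 = 0"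
proof -
  have "{D. D division_of {0..0::real}} = {{{0}}}"
    by (auto simp: division_of_sing[of _ "0::real", simplified])
  then show ?thesis by (simp add: arclength_def chord_sum_def)
qed

section \<open>The measure |dz| has no atoms\<close>

text \<open>A simple path takes the value \<open>z\<close> at finitely many parameters, each with
  one arclength value; so the preimage of \<open>z\<close> under \<open>arclength_param g\<close> is
  finite, hence Lebesgue null.\<close>

lemma singleton_null_sets_arclength_measure:
  assumes "simple_path g" "rectifiable_path g" "z \<in> path_image g"
  shows "{z} \<in> null_sets (arclength_measure g)"
proof -
  define L where "L = arclength g 1"
  define P where "P = arclength_param g -` {z} \<inter> space (restrict_space lborel {0..L})"
  define D where "D = distr (restrict_space lborel {0..L}) (restrict_space borel (path_image g)) (arclength_param g)"
  have "P \<subseteq> arclength g ` {t \<in> {0..1}. g t = z}"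
  proof
    fix s assume s: "s \<in> P"
    \<comment> \<open>By continuity \<open>s\<close> is a value of \<open>arclength g\<close>, so
      \<open>inv_into\<close> returns a genuine preimage.\<close>
    then have "s \<in> arclength g ` {0..1}"
      using IVT'[OF _ _ _ continuous_on_arclength[OF assms(2)], of s]
      by (auto simp: P_def L_def arclength_0 space_restrict_space)
    then have "inv_into {0..1} (arclength g) s \<in> {0..1}"
      "arclength g (inv_into {0..1} (arclength g) s) = s"
      by (rule inv_into_into, rule f_inv_into_f)
    moreover have "g (inv_into {0..1} (arclength g) s) = z"
      using s by (simp add: P_def arclength_param_def)
    ultimately show "s \<in> arclength g ` {t \<in> {0..1}. g t = z}" by force
  qed
  moreover have "finite {t \<in> {0..1}. g t = z}"
  proof -
    obtain u where u: "u \<in> {0..1}" "g u = z" using assms(3) by (auto simp: path_image_def)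
    have "{t \<in> {0..1}. g t = z} \<subseteq> {u, 0, 1}"
      using assms(1) u by (fastforce simp: simple_path_def loop_free_def)
    then show ?thesis by (rule finite_subset) simp
  qed
  ultimately have "finite P" by (meson finite_imageI finite_subset)
  then have "emeasure (restrict_space lborel {0..L}) P = 0"
    by (subst emeasure_restrict_space)
      (auto simp: P_def space_restrict_space intro!: emeasure_lborel_countable countable_finite)
  \<comment> \<open>Were \<open>arclength_param g\<close> not measurable, \<open>distr\<close> would give either the measure of the preimage
    or the zero measure; both vanish on \<open>{z}\<close>.\<close>
  then have "emeasure D {z} = 0"
    by (simp add: D_def distr_def emeasure_measure_of_conv P_def)
  moreover have "{z} \<in> sets D"
    using assms(3) by (auto simp: D_def sets_restrict_space intro!: image_eqI[of _ _ "{z}"])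
  ultimately show ?thesis
    unfolding arclength_measure_def D_def L_def by (auto simp: null_sets_def)
qed

lemma space_arclength_measure: "space (arclength_measure g) = path_image g"
  by (simp add: arclength_measure_def space_restrict_space)

lemma borel_measurable_arclength_measure:
  fixes F :: "'a::metric_space \<Rightarrow> 'b::metric_space"
  assumes "continuous_on (path_image g) F"
  shows "F \<in> borel_measurable (arclength_measure g)"
  unfolding arclength_measure_def
  by (intro measurable_completion)
    (simp add: borel_measurable_continuous_on_restrict[OF assms])

lemma AE_arclength_measure_neq:
  assumes "simple_path g" "rectifiable_path g" "inj_on F (path_image g)"
  shows "AE x in arclength_measure g. F x \<noteq> z"
proof (cases "z \<in> F ` path_image g")
  case True
  then obtain y where y: "y \<in> path_image g" "z = F y" by blast
  have "AE x in arclength_measure g. x \<notin> {y}"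
    using assms y by (intro AE_not_in singleton_null_sets_arclength_measure)
  then show ?thesis
    using AE_space
    by eventually_elim (use y assms(3) in \<open>auto simp: space_arclength_measure inj_on_eq_iff\<close>)
next
  case False
  then show ?thesis by (intro AE_I2) (auto simp: space_arclength_measure)
qed

subsection \<open>Moebius transformations of the disk\<close>

text \<open>On the circle \<open>z * cnj z = 1\<close>, so the left side factors as
  \<open>z * cnj (z + w)\<close>.\<close>

lemma norm_1_plus_mult_cnj:
  assumes "cmod z = 1"
  shows "cmod (1 + z * cnj w) = cmod (z + w)"
proof -
  have "z * cnj z = 1"
    using assms by (simp add: complex_norm_square[symmetric])
  then have "1 + z * cnj w = z * cnj (z + w)" by (simp add: algebra_simps)
  then show ?thesis
    by (metis assms complex_mod_cnj mult_1 norm_mult)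
qed

lemma one_plus_mult_cnj_neq_0:
  assumes "cmod z = 1" "z \<noteq> - w"
  shows "1 + z * cnj w \<noteq> 0"
  using norm_1_plus_mult_cnj[OF assms(1), of w] assms(2)
  by (metis add_eq_0_iff2 norm_eq_zero)

lemma one_plus_mult_cnj_neq_0_ball:
  assumes "cmod z = 1" "cmod w < 1"
  shows "1 + z * cnj w \<noteq> 0"
  by (rule one_plus_mult_cnj_neq_0) (use assms in auto)

text \<open>The modulus is 1 except at \<open>z = - w\<close>, where division by zero gives 0. This
  supplies the bound for dominated convergence.\<close>

lemma norm_disk_moebius_le_1:
  assumes "cmod z = 1"
  shows "cmod (disk_moebius w z) \<le> 1"
  using norm_1_plus_mult_cnj[OF assms, of w]
  by (simp add: disk_moebius_def norm_divide divide_le_eq_1)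

lemma norm_disk_moebius_eq_1:
  assumes "cmod z = 1" "cmod w < 1"
  shows "cmod (disk_moebius w z) = 1"
proof -
  have "z \<noteq> - w" using assms by auto
  then show ?thesis
    using norm_1_plus_mult_cnj[OF assms(1), of w] assms
    by (simp add: disk_moebius_def norm_divide add_eq_0_iff2)
qed

lemma disk_moebius_boundary:
  assumes "cmod z = 1" "cmod w = 1" "z \<noteq> - w"
  shows "disk_moebius w z = w"
proof -
  have "w * cnj w = 1"
    using assms by (simp add: complex_norm_square[symmetric])
  then have "z + w = w * (1 + z * cnj w)" by (simp add: algebra_simps)
  then show ?thesis
    using one_plus_mult_cnj_neq_0[of z w] assms by (simp add: disk_moebius_def)
qed

text \<open>After clearing denominators, numerator and denominator share the factor
  \<open>r\<close>, which cancels. The denominators \<open>q\<close> and \<open>cnj q\<close> leave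
  a rotation, which does not affect whether an integral vanishes.\<close>

lemma disk_moebius_comp:
  assumes "cmod z = 1" "cmod u < 1" "cmod v < 1"
  defines "q \<equiv> 1 - v * cnj u"
  shows "disk_moebius ((v - u) / q) (disk_moebius u z) = cnj q / q * disk_moebius v z"
proof -
  define r where "r = 1 - u * cnj u"
  have "cmod (cnj v * u) < 1" "cmod (u * cnj u) < 1"
    using mult_strict_mono'[of "cmod v" 1 "cmod u" 1] mult_strict_mono'[of "cmod u" 1 "cmod u" 1] assms
    by (simp_all add: norm_mult)
  then have "cnj q \<noteq> 0" and r: "r \<noteq> 0" by (auto simp: q_def r_def)
  then have q: "q \<noteq> 0" "cnj q \<noteq> 0" by auto
  have u: "1 + z * cnj u \<noteq> 0" using one_plus_mult_cnj_neq_0_ball assms by blast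
  have v: "1 + z * cnj v \<noteq> 0" using one_plus_mult_cnj_neq_0_ball assms by blast
  have "q * (z + u) + (v - u) * (1 + z * cnj u) = r * (z + v)"
    by (simp add: q_def r_def algebra_simps)
  then have 1: "disk_moebius u z + (v - u) / q = r * (z + v) / (q * (1 + z * cnj u))"
    using q u by (simp add: disk_moebius_def add_frac_eq mult.commute)
  have "cnj q * (1 + z * cnj u) + (z + u) * cnj (v - u) = r * (1 + z * cnj v)"
    by (simp add: q_def r_def algebra_simps)
  moreover have "1 + disk_moebius u z * cnj ((v - u) / q) =
      (cnj q * (1 + z * cnj u) + (z + u) * cnj (v - u)) / (cnj q * (1 + z * cnj u))"
    using q u unfolding add_divide_distrib[of "cnj q * (1 + z * cnj u)"]
    by (simp add: disk_moebius_def mult.commute)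
  ultimately have 2: "1 + disk_moebius u z * cnj ((v - u) / q) =
      r * (1 + z * cnj v) / (cnj q * (1 + z * cnj u))"
    by simp
  show ?thesis
    unfolding disk_moebius_def[of "(v - u) / q"] 1 2
    using q r u v by (simp add: disk_moebius_def)
qed

lemma disk_moebius_minus_cancel:
  assumes "cmod z = 1" "cmod u < 1"
  shows "disk_moebius (- u) (disk_moebius u z) = z"
proof -
  define c where "c = disk_moebius u z"
  have "cmod c = 1" using norm_disk_moebius_eq_1[OF assms] by (simp add: c_def)
  then have "1 - c * cnj u \<noteq> 0"
    using one_plus_mult_cnj_neq_0_ball[of c "- u"] assms by simp
  moreover have "1 + z * cnj u \<noteq> 0"
    using one_plus_mult_cnj_neq_0_ball assms by blast
  then have "c * (1 + z * cnj u) = z + u" by (simp add: c_def disk_moebius_def)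
  then have "c - u = z * (1 - c * cnj u)" by (simp add: algebra_simps)
  ultimately have "disk_moebius (- u) c = z" by (simp add: disk_moebius_def)
  then show ?thesis by (simp add: c_def)
qed

text \<open>With \<open>p = z * cnj a\<close> the product is
  \<open>p * (cnj p - p) / (1 + p)\<close>, and \<open>cnj p - p\<close> is purely
  imaginary.\<close>

lemma Re_cnj_disk_moebius_diff:
  assumes "cmod z = 1" "1 + z * cnj a \<noteq> 0"
  shows "Re (cnj a * (disk_moebius a z - z)) = 2 * (Im (z * cnj a))\<^sup>2 / (cmod (1 + z * cnj a))\<^sup>2"
proof -
  define p where "p = z * cnj a"
  have "a * cnj a = p * cnj p"
    using assms(1) by (simp only: p_def complex_norm_square[symmetric] norm_mult complex_mod_cnj mult_1)
  moreover have "disk_moebius a z - z = (a - z * p) / (1 + p)"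
    using assms(2) by (simp add: disk_moebius_def p_def field_simps)
  then have "cnj a * (disk_moebius a z - z) = (a * cnj a - p * p) / (1 + p)"
    by (simp add: p_def right_diff_distrib mult_ac)
  ultimately have "cnj a * (disk_moebius a z - z) = (p * cnj p - p * p) / (1 + p)"
    by simp
  also have "\<dots> = (p * cnj p - p * p) * cnj (1 + p) / (cmod (1 + p))\<^sup>2"
    by (rule complex_div_cnj)
  also have "Re \<dots> = Re ((p * cnj p - p * p) * cnj (1 + p)) / (cmod (1 + p))\<^sup>2"
    by simp
  also have "Re ((p * cnj p - p * p) * cnj (1 + p)) = 2 * (Im p)\<^sup>2"
    by (simp add: algebra_simps power2_eq_square)
  finally show ?thesis by (simp add: p_def)
qed

section \<open>Moments of an atomless measure on the circle\<close>

locale atomless_circle_map =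
  fixes M :: "'a measure" and F :: "'a \<Rightarrow> complex" and f :: "'a \<Rightarrow> real"
  assumes F_measurable [measurable]: "F \<in> borel_measurable M"
    and norm_F: "x \<in> space M \<Longrightarrow> cmod (F x) = 1"
    and AE_F_neq: "AE x in M. F x \<noteq> z"
    and f_integrable: "integrable M f"
    and f_nonneg: "x \<in> space M \<Longrightarrow> 0 \<le> f x"
    and f_pos: "0 < integral\<^sup>L M f"
begin

text \<open>This is the map \<open>H\<close> of the introduction. For |w| = 1 the default value 0 of
  \<open>disk_moebius w\<close> at \<open>- w\<close> affects only a null set.\<close>

definition moment :: "complex \<Rightarrow> complex" where
  "moment w = (LINT x|M. disk_moebius w (F x) * complex_of_real (f x))"

lemma f_measurable [measurable]: "f \<in> borel_measurable M"
  using f_integrable by auto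

lemma moebius_measurable [measurable]: "(\<lambda>x. disk_moebius w (F x)) \<in> borel_measurable M"
  unfolding disk_moebius_def by measurable

lemma norm_moebius_F_mult_le:
  "x \<in> space M \<Longrightarrow> cmod (disk_moebius w (F x) * complex_of_real (f x)) \<le> f x"
  using norm_disk_moebius_le_1[OF norm_F[of x], of w] f_nonneg[of x]
  by (simp add: norm_mult mult_left_le_one_le)

lemma moebius_integrable: "integrable M (\<lambda>x. disk_moebius w (F x) * complex_of_real (f x))"
  by (rule Bochner_Integration.integrable_bound[OF f_integrable])
    (use norm_moebius_F_mult_le in \<open>auto intro!: AE_I2 order_trans[OF _ abs_ge_self]\<close>)

text \<open>For a fixed limit \<open>w\<close> the integrands converge wherever
  \<open>F x \<noteq> - w\<close>, hence almost everywhere, and \<open>f\<close> dominates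
  them.\<close>

lemma continuous_on_moment: "continuous_on (cball 0 1) moment"
  unfolding continuous_on_sequentially
proof (intro allI ballI impI)
  fix X :: "nat \<Rightarrow> complex" and w :: complex
  assume w: "w \<in> cball 0 1" and X: "(\<forall>n. X n \<in> cball 0 1) \<and> X \<longlonglongrightarrow> w"
  have "AE x in M. (\<lambda>n. disk_moebius (X n) (F x) * complex_of_real (f x))
      \<longlonglongrightarrow> disk_moebius w (F x) * complex_of_real (f x)"
    using AE_F_neq[of "- w"]
  proof (rule AE_mp, intro AE_I2 impI)
    fix x assume "x \<in> space M" "F x \<noteq> - w"
    then have "1 + F x * cnj w \<noteq> 0"
      using one_plus_mult_cnj_neq_0 norm_F by auto
    then show "(\<lambda>n. disk_moebius (X n) (F x) * complex_of_real (f x))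
      \<longlonglongrightarrow> disk_moebius w (F x) * complex_of_real (f x)"
      unfolding disk_moebius_def using X by (intro tendsto_intros) auto
  qed
  then show "(moment \<circ> X) \<longlonglongrightarrow> moment w"
    unfolding moment_def comp_def
    by (intro integral_dominated_convergence[where w=f])
      (auto intro!: AE_I2 norm_moebius_F_mult_le f_integrable)
qed

lemma moment_boundary:
  assumes "cmod w = 1"
  shows "moment w = w * complex_of_real (integral\<^sup>L M f)"
proof -
  have "AE x in M. disk_moebius w (F x) * complex_of_real (f x) = w * complex_of_real (f x)"
    using AE_F_neq[of "- w"]
    by (rule AE_mp) (intro AE_I2 impI, use assms norm_F in \<open>simp add: disk_moebius_boundary\<close>)
  then have "moment w = (LINT x|M. w * complex_of_real (f x))"
    unfolding moment_def by (intro integral_cong_AE) auto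
  then show ?thesis by simp
qed

text \<open>Otherwise \<open>sgn \<circ> moment\<close> would retract the closed disk onto its boundary.\<close>

lemma moment_zero_exists: "\<exists>w\<in>ball 0 1. moment w = 0"
proof (rule ccontr)
  assume "\<not> ?thesis"
  then have nz: "moment w \<noteq> 0" if "w \<in> cball 0 1" for w
    using that moment_boundary[of w] f_pos by (cases "cmod w = 1") auto
  have "retraction (cball 0 1) (frontier (cball 0 1)) (\<lambda>w. sgn (moment w))"
    unfolding retraction_def
  proof (intro conjI ballI)
    show "continuous_on (cball 0 1) (\<lambda>w. sgn (moment w))"
      unfolding sgn_div_norm using nz by (intro continuous_intros continuous_on_moment) auto
    show "(\<lambda>w. sgn (moment w)) \<in> cball 0 1 \<rightarrow> frontier (cball 0 1)"
      using nz by (auto simp: norm_sgn)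
    fix w :: complex assume "w \<in> frontier (cball 0 1)"
    then have "cmod w = 1" by simp
    then show "sgn (moment w) = w"
      using f_pos by (simp add: moment_boundary sgn_mult sgn_of_real) (simp add: sgn_div_norm)
  qed auto
  then show False
    using no_retraction_cball[of 1 "0::complex"] by (auto simp: retract_of_def)
qed

text \<open>A second zero \<open>v\<close> gives an \<open>a\<close> such that \<open>z \<mapsto> disk_moebius a z - z\<close> has mean zero against
  the image measure under \<open>disk_moebius u \<circ> F\<close>, yet its component in direction \<open>a\<close> is
  nonnegative on the circle and vanishes at only two points, unless \<open>a = 0\<close>.\<close>

lemma moment_zero_unique:
  assumes u: "u \<in> ball 0 1" "moment u = 0" and v: "v \<in> ball 0 1" "moment v = 0"
  shows "u = v"
proof (rule ccontr)
  assume "u \<noteq> v"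
  define q where "q = 1 - v * cnj u"
  define a where "a = (v - u) / q"
  define Z where "Z x = disk_moebius u (F x)" for x
  define d where "d x = Re (cnj a * (disk_moebius a (Z x) - Z x)) * f x" for x
  have uv: "cmod u < 1" "cmod v < 1" using u v by auto
  have "cmod (v * cnj u) < 1"
    using mult_strict_mono'[of "cmod v" 1 "cmod u" 1] uv by (simp add: norm_mult)
  then have "q \<noteq> 0" by (auto simp: q_def)
  then have "a \<noteq> 0" using \<open>u \<noteq> v\<close> by (simp add: a_def)
  have Z1: "cmod (Z x) = 1" if "x \<in> space M" for x
    using norm_disk_moebius_eq_1 norm_F uv that by (simp add: Z_def)
  define b where "b = cnj q / q"
  have comp: "disk_moebius a (Z x) = b * disk_moebius v (F x)" if "x \<in> space M" for x
    unfolding a_def b_def q_def Z_def by (rule disk_moebius_comp[OF norm_F[OF that] uv])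
  \<comment> \<open>Linear in the integrands of \<open>moment v\<close> and \<open>moment u\<close>,
    so its integral vanishes with both moments.\<close>
  define D where "D x = cnj a * b * (disk_moebius v (F x) * complex_of_real (f x))
      - cnj a * (disk_moebius u (F x) * complex_of_real (f x))" for x
  have d: "d x = Re (D x)" if "x \<in> space M" for x
  proof -
    have "d x = Re (cnj a * (disk_moebius a (Z x) - Z x) * complex_of_real (f x))"
      by (simp add: d_def)
    then show ?thesis
      unfolding comp[OF that] D_def unfolding Z_def by (simp only: algebra_simps)
  qed
  have D: "integrable M D"
    unfolding D_def
    by (intro Bochner_Integration.integrable_diff integrable_mult_right moebius_integrable)
  then have int: "integrable M d"
    by (subst Bochner_Integration.integrable_cong[OF refl d]) (auto intro: integrable_Re)
  have "integral\<^sup>L M d = Re (integral\<^sup>L M D)"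
    by (subst Bochner_Integration.integral_cong[OF refl d]) (auto simp: integral_Re D)
  also have "integral\<^sup>L M D = cnj a * b * moment v - cnj a * moment u"
    unfolding D_def moment_def
    by (simp only: Bochner_Integration.integral_diff integrable_mult_right moebius_integrable
        integral_mult_right_zero)
  finally have "integral\<^sup>L M d = Re (cnj a * b * moment v - cnj a * moment u)" .
  then have d0: "integral\<^sup>L M d = 0" using u v by simp
  have sq: "d x = 2 * (Im (Z x * cnj a))\<^sup>2 / (cmod (1 + Z x * cnj a))\<^sup>2 * f x"
    if "x \<in> space M" "1 + Z x * cnj a \<noteq> 0" for x
    using Re_cnj_disk_moebius_diff[OF Z1[OF that(1)] that(2)] by (simp add: d_def)
  \<comment> \<open>A zero denominator would make \<open>disk_moebius a (Z x)\<close> equal to 0,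
    yet it is a rotation of a point on the circle.\<close>
  have nz: "1 + Z x * cnj a \<noteq> 0" if "x \<in> space M" for x
  proof -
    have "disk_moebius v (F x) \<noteq> 0"
      using norm_disk_moebius_eq_1[OF norm_F[OF that] uv(2)] by auto
    then have "disk_moebius a (Z x) \<noteq> 0"
      using comp[OF that] \<open>q \<noteq> 0\<close> by (simp add: b_def)
    then show ?thesis by (auto simp: disk_moebius_def)
  qed
  \<comment> \<open>Since \<open>c\<close> equals \<open>a / cmod a\<close>, the points
    \<open>c\<close> and \<open>- c\<close> are the only ones on the circle where
    \<open>Im (z * cnj a) = 0\<close>; they are pulled back below by
    \<open>disk_moebius (- u)\<close>.\<close>
  define c where "c = complex_of_real (cmod a) / cnj a"
  have "AE x in M. d x = 0"
  proof (subst integral_nonneg_eq_0_iff_AE[symmetric, OF int])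
    show "AE x in M. 0 \<le> d x"
      using f_nonneg nz by (intro AE_I2) (simp add: sq)
  qed (rule d0)
  then have "AE x in M. f x = 0"
    using AE_F_neq[of "disk_moebius (- u) c"] AE_F_neq[of "disk_moebius (- u) (- c)"] AE_space
  proof eventually_elim
    fix x assume dx: "d x = 0" and x: "x \<in> space M"
      and F: "F x \<noteq> disk_moebius (- u) c" "F x \<noteq> disk_moebius (- u) (- c)"
    show "f x = 0"
    proof (rule ccontr)
      assume "f x \<noteq> 0"
      then have "Im (Z x * cnj a) = 0"
        using dx sq[OF x nz[OF x]] nz[OF x] by (simp del: times_complex.sel)
      then have "Z x * cnj a = of_real (Re (Z x * cnj a))"
        by (simp add: complex_eq_iff)
      moreover have "\<bar>Re (Z x * cnj a)\<bar> = cmod a"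
        using \<open>Im (Z x * cnj a) = 0\<close> cmod_eq_Re[of "Z x * cnj a"] Z1[OF x] by (simp add: norm_mult)
      ultimately have "Z x * cnj a = of_real (cmod a) \<or> Z x * cnj a = - of_real (cmod a)"
        by (metis abs_if minus_minus of_real_minus)
      then have "Z x = c \<or> Z x = - c"
        using \<open>a \<noteq> 0\<close> by (auto simp: c_def field_simps)
      then show False
        using F disk_moebius_minus_cancel[OF norm_F[OF x] uv(1)] by (auto simp: Z_def)
    qed
  qed
  then have "integral\<^sup>L M f = 0" by (rule integral_eq_zero_AE)
  then show False using f_pos by simp
qed

end

section \<open>Application to |dz| on a Jordan curve\<close>

theorem corollary8:
  fixes J :: "complex set" and g :: "real \<Rightarrow> complex"
    and f :: "complex \<Rightarrow> real" and F :: "complex \<Rightarrow> complex"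
  assumes "simple_path g" and "pathfinish g = pathstart g" and "path_image g = J"
    and "rectifiable_path g"
    and "\<And>z. z \<in> J \<Longrightarrow> 0 \<le> f z"
    and "integrable (arclength_measure g) f"
    and "0 < (LINT z|arclength_measure g. f z)"
    and "\<exists>G. homeomorphism J (sphere 0 1) F G"
  shows "\<exists>!w. w \<in> ball 0 1 \<and>
    (LINT z|arclength_measure g. disk_moebius w (F z) * complex_of_real (f z)) = 0"
proof -
  obtain G where G: "homeomorphism J (sphere 0 1) F G" using assms(8) by blast
  interpret atomless_circle_map "arclength_measure g" F f
  proof
    show "F \<in> borel_measurable (arclength_measure g)"
      using G assms(3) by (intro borel_measurable_arclength_measure) (simp add: homeomorphism_def)
    show "cmod (F x) = 1" if "x \<in> space (arclength_measure g)" for x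
      using that G assms(3) by (auto simp: space_arclength_measure homeomorphism_def)
    have "inj_on F J" using G by (metis homeomorphism_def inj_onI)
    then show "AE x in arclength_measure g. F x \<noteq> z" for z
      using assms by (intro AE_arclength_measure_neq) auto
  qed (use assms in \<open>auto simp: space_arclength_measure\<close>)
  show ?thesis
    unfolding moment_def[symmetric]
    using moment_zero_exists moment_zero_unique by blast
qed

end
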